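(* Every representation $\rho: SB_2 \to \mathrm{GL}_2(\mathbb{C})$ is reducible.
   Context: The singular braid group $SB_2$ on two strands is the group generated by $\sigma_1,\tau_1$ with the single defining relation $\sigma_1\tau_1=\tau_1\sigma_1$. A representation $G\to \mathrm{GL}_m(\mathbb{C})$ is reducible if there is a subspace of $\mathbb{C}^m$, different from $0$ and $\mathbb{C}^m$, that is invariant under the image of $G$. *)

theory Defs
  imports "HOL-Analysis.Analysis" "HOL-Algebra.Group"
begin

text \<open>Words over a type of generators: the letter \<open>(a, True)\<close> stands for the generator \<open>a\<close>,
  the letter \<open>(a, False)\<close> for its formal inverse.\<close>

type_synonym 'a word = "('a \<times> bool) list"

text \<open>For a set \<open>R\<close> of relations \<open>u = v\<close>, this is the congruence on words whose quotient is the
  group presented by all elements of type \<open>'a\<close> as generators, subject to the relations \<open>R\<close>.\<close>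

inductive word_eq :: "('a word \<times> 'a word) set \<Rightarrow> 'a word \<Rightarrow> 'a word \<Rightarrow> bool"
  for R :: "('a word \<times> 'a word) set"
where
  rel: "(u, v) \<in> R \<Longrightarrow> word_eq R u v"
| cancel: "word_eq R [(a, b), (a, \<not> b)] []"
| refl: "word_eq R u u"
| sym: "word_eq R u v \<Longrightarrow> word_eq R v u"
| trans: "word_eq R u v \<Longrightarrow> word_eq R v w \<Longrightarrow> word_eq R u w"
| append: "word_eq R u v \<Longrightarrow> word_eq R u' v' \<Longrightarrow> word_eq R (u @ u') (v @ v')"

definition word_class :: "('a word \<times> 'a word) set \<Rightarrow> 'a word \<Rightarrow> 'a word set" where
  "word_class R u = {v. word_eq R u v}"

definition presented_group :: "('a word \<times> 'a word) set \<Rightarrow> 'a word set monoid" where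
  "presented_group R =
    \<lparr>carrier = range (word_class R),
     mult = (\<lambda>A B. {w. \<exists>u\<in>A. \<exists>v\<in>B. word_eq R (u @ v) w}),
     one = word_class R []\<rparr>"

lemma word_class_eq_iff: "word_class R u = word_class R v \<longleftrightarrow> word_eq R u v"
  unfolding word_class_def by (auto intro: word_eq.intros)

lemma mult_presented_group:
  "word_class R u \<otimes>\<^bsub>presented_group R\<^esub> word_class R v = word_class R (u @ v)"
  unfolding presented_group_def word_class_def
  by (auto intro: word_eq.trans word_eq.append word_eq.refl)

lemma word_eq_inverse: "\<exists>v. word_eq R (v @ u) []"
proof (induction u)
  case Nil
  show ?case by (rule exI[of _ "[]"]) (simp add: word_eq.refl)
next
  case (Cons x u)
  then obtain v where v: "word_eq R (v @ u) []" by blast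
  obtain a b where x: "x = (a, b)" by (cases x)
  have "word_eq R (v @ ([(a, \<not> b), (a, b)] @ u)) (v @ ([] @ u))"
    using word_eq.cancel[of R a "\<not> b"] by (intro word_eq.append word_eq.refl) simp
  then have "word_eq R ((v @ [(a, \<not> b)]) @ x # u) []"
    using v x by (auto intro: word_eq.trans)
  then show ?case by blast
qed

lemma group_presented_group: "group (presented_group R)"
proof (rule groupI)
  have car: "carrier (presented_group R) = range (word_class R)"
    and one: "\<one>\<^bsub>presented_group R\<^esub> = word_class R []"
    by (simp_all add: presented_group_def)
  show "\<one>\<^bsub>presented_group R\<^esub> \<in> carrier (presented_group R)"
    by (simp add: car one)
  fix x assume x: "x \<in> carrier (presented_group R)"
  then obtain u where u: "x = word_class R u" by (auto simp: car)
  show "\<one>\<^bsub>presented_group R\<^esub> \<otimes>\<^bsub>presented_group R\<^esub> x = x"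
    by (simp add: u one mult_presented_group)
  obtain v where "word_eq R (v @ u) []" using word_eq_inverse by blast
  then show "\<exists>y\<in>carrier (presented_group R). y \<otimes>\<^bsub>presented_group R\<^esub> x = \<one>\<^bsub>presented_group R\<^esub>"
    by (auto simp: car one u mult_presented_group word_class_eq_iff)
  fix y assume "y \<in> carrier (presented_group R)"
  then obtain v where v: "y = word_class R v" by (auto simp: car)
  show "x \<otimes>\<^bsub>presented_group R\<^esub> y \<in> carrier (presented_group R)"
    by (simp add: car u v mult_presented_group)
  fix z assume "z \<in> carrier (presented_group R)"
  then obtain w where w: "z = word_class R w" by (auto simp: car)
  show "x \<otimes>\<^bsub>presented_group R\<^esub> y \<otimes>\<^bsub>presented_group R\<^esub> z =
      x \<otimes>\<^bsub>presented_group R\<^esub> (y \<otimes>\<^bsub>presented_group R\<^esub> z)"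
    by (simp add: u v w mult_presented_group)
qed

datatype sb2_gen = Sigma1 | Tau1

definition SB2 :: "sb2_gen word set monoid" where
  "SB2 = presented_group
     {([(Sigma1, True), (Tau1, True)], [(Tau1, True), (Sigma1, True)])}"

lemma group_SB2: "group SB2"
  by (simp add: SB2_def group_presented_group)

definition GL :: "('k::field ^ 'n ^ 'n) monoid" where
  "GL = \<lparr>carrier = {A. invertible A}, mult = (**), one = mat 1\<rparr>"

lemma group_GL: "group (GL :: ('k::field ^ 'n ^ 'n) monoid)"
proof (rule groupI)
  fix A assume "A \<in> carrier (GL :: ('k::field ^ 'n ^ 'n) monoid)"
  then have "invertible A" by (simp add: GL_def)
  then obtain B where "A ** B = mat 1" "B ** A = mat 1" by (auto simp: invertible_def)
  then show "\<exists>B\<in>carrier GL. B \<otimes>\<^bsub>GL\<^esub> A = \<one>\<^bsub>GL\<^esub>"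
    by (auto simp: GL_def invertible_def)
qed (auto simp: GL_def invertible_mult matrix_mul_assoc invertible_def[of "mat 1"])

definition reducible :: "('g, 'm) monoid_scheme \<Rightarrow> ('g \<Rightarrow> complex ^ 'n ^ 'n) \<Rightarrow> bool" where
  "reducible G \<rho> \<longleftrightarrow>
    (\<exists>W. vec.subspace W \<and> W \<noteq> {0} \<and> W \<noteq> UNIV \<and>
         (\<forall>g\<in>carrier G. \<forall>w\<in>W. \<rho> g *v w \<in> W))"

end

theory Submission
  imports Defs
begin

text \<open>A representation of \<open>SB2\<close> is a pair of commuting invertible matrices, and commuting complex
  matrices have a common eigenvector. It spans a line that is invariant under both generators,
  hence under their inverses, hence under every word.\<close>

lemma quadratic_root_exists:
  fixes p q :: complex
  shows "\<exists>x. x\<^sup>2 - p * x + q = 0"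
proof
  define s where "s = csqrt (p\<^sup>2 - 4 * q)"
  have "s\<^sup>2 = p\<^sup>2 - 4 * q"
    by (simp add: s_def)
  then have q: "q = (p\<^sup>2 - s\<^sup>2) / 4"
    by simp
  show "((p + s) / 2)\<^sup>2 - p * ((p + s) / 2) + q = 0"
    unfolding q by (simp add: power2_eq_square field_simps)
qed

lemma eigenvector_exists_2:
  fixes A :: "complex ^ 2 ^ 2"
  shows "\<exists>k v. v \<noteq> 0 \<and> A *v v = k *s v"
proof (cases "A $ 1 $ 2 = 0")
  case True
  have "vector [0, 1] \<noteq> (0 :: complex ^ 2)"
    by (simp add: vec_eq_iff forall_2)
  moreover have "A *v vector [0, 1] = A $ 2 $ 2 *s vector [0, 1]"
    by (simp add: vec_eq_iff forall_2 matrix_vector_mult_def sum_2 True)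
  ultimately show ?thesis by blast
next
  case False
  obtain k where k: "k\<^sup>2 - (A $ 1 $ 1 + A $ 2 $ 2) * k
      + (A $ 1 $ 1 * A $ 2 $ 2 - A $ 1 $ 2 * A $ 2 $ 1) = 0"
    using quadratic_root_exists by blast
  define v :: "complex ^ 2" where "v = vector [A $ 1 $ 2, k - A $ 1 $ 1]"
  have "v \<noteq> 0"
    using False by (simp add: v_def vec_eq_iff forall_2)
  moreover have "A *v v = k *s v"
    using k by (simp add: v_def vec_eq_iff forall_2 matrix_vector_mult_def sum_2
        power2_eq_square algebra_simps)
  ultimately show ?thesis by blast
qed

lemma kernel_vectors_proportional_2:
  fixes N :: "'a::field ^ 2 ^ 2"
  assumes "N \<noteq> 0" "N *v v = 0" "N *v w = 0" "v \<noteq> 0"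
  shows "\<exists>k. w = k *s v"
proof -
  obtain i where i: "N $ i $ 1 \<noteq> 0 \<or> N $ i $ 2 \<noteq> 0"
    using assms(1) by (auto simp: vec_eq_iff forall_2)
  have row: "N $ i $ 1 * u $ 1 + N $ i $ 2 * u $ 2 = 0" if "N *v u = 0" for u
    using arg_cong[OF that, of "\<lambda>x. x $ i"] by (simp add: matrix_vector_mult_def sum_2)
  have "N $ i $ 1 * (v $ 1 * w $ 2 - v $ 2 * w $ 1) = 0"
       "N $ i $ 2 * (v $ 1 * w $ 2 - v $ 2 * w $ 1) = 0"
    using row[OF assms(2)] row[OF assms(3)] by algebra+
  then have det: "v $ 1 * w $ 2 = v $ 2 * w $ 1"
    using i by auto
  have "v $ 1 \<noteq> 0 \<or> v $ 2 \<noteq> 0"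
    using assms(4) by (auto simp: vec_eq_iff forall_2)
  then show ?thesis
  proof
    assume "v $ 1 \<noteq> 0"
    then have "w = (w $ 1 / v $ 1) *s v"
      using det by (simp add: vec_eq_iff forall_2 field_simps)
    then show ?thesis ..
  next
    assume "v $ 2 \<noteq> 0"
    then have "w = (w $ 2 / v $ 2) *s v"
      using det by (simp add: vec_eq_iff forall_2 field_simps)
    then show ?thesis ..
  qed
qed

lemma commuting_matrices_common_eigenvector_2:
  fixes A B :: "complex ^ 2 ^ 2"
  assumes "A ** B = B ** A"
  obtains v k l where "v \<noteq> 0" "A *v v = k *s v" "B *v v = l *s v"
proof -
  obtain k v where v: "v \<noteq> 0" "A *v v = k *s v"
    using eigenvector_exists_2 by blast
  have scalar: "(A - mat k) *v u = A *v u - k *s u" for u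
    by (simp add: matrix_vector_mult_def mat_def vec_eq_iff forall_2 sum_2 algebra_simps)
  show ?thesis
  proof (cases "A - mat k = 0")
    case True
    then have "A *v u = k *s u" for u
      using scalar[of u] by simp
    then show ?thesis
      using that eigenvector_exists_2[of B] by blast
  next
    case False
    have "A *v (B *v v) = B *v (A *v v)"
      by (simp add: matrix_vector_mul_assoc assms)
    also have "\<dots> = k *s (B *v v)"
      by (simp add: v(2) vector_scalar_commute)
    finally have "(A - mat k) *v (B *v v) = 0"
      by (simp add: scalar)
    then obtain l where "B *v v = l *s v"
      using kernel_vectors_proportional_2[OF False] v scalar by force
    then show ?thesis
      using that v by blast
  qed
qed

lemma eigenvector_left_inverse:
  fixes A B :: "'a::field ^ 'n ^ 'n"
  assumes "B ** A = mat 1" "v \<noteq> 0" "A *v v = k *s v"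
  shows "B *v v = inverse k *s v"
proof -
  have v: "v = k *s (B *v v)"
    by (metis assms(1,3) matrix_vector_mul_assoc matrix_vector_mul_lid vector_scalar_commute)
  with assms(2) have "k \<noteq> 0" by auto
  then have "inverse k *s (k *s (B *v v)) = B *v v"
    by (simp add: vector_smult_assoc)
  with v show ?thesis by simp
qed

lemma presented_group_hom_eigenvector:
  fixes \<rho> :: "'a word set \<Rightarrow> 'k::field ^ 'n ^ 'n"
  assumes hom: "\<rho> \<in> hom (presented_group R) GL"
    and v: "v \<noteq> 0"
    and gen: "\<And>a. \<exists>k. \<rho> (word_class R [(a, True)]) *v v = k *s v"
    and g: "g \<in> carrier (presented_group R)"
  shows "\<exists>k. \<rho> g *v v = k *s v"
proof -
  have mult: "\<rho> (word_class R (u @ w)) = \<rho> (word_class R u) ** \<rho> (word_class R w)" for u w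
    using hom_mult[OF hom, of "word_class R u" "word_class R w"]
    by (simp add: mult_presented_group) (simp add: presented_group_def GL_def)
  have one: "\<rho> (word_class R []) = mat 1"
    using hom_one[OF hom group_presented_group group_GL] by (simp add: presented_group_def GL_def)
  have letter: "\<exists>k. \<rho> (word_class R [(a, b)]) *v v = k *s v" for a b
  proof (cases b)
    case True
    then show ?thesis using gen by simp
  next
    case False
    have "word_class R [(a, False), (a, True)] = word_class R []"
      using word_eq.cancel[of R a False] by (simp add: word_class_eq_iff)
    then have "\<rho> (word_class R [(a, False)]) ** \<rho> (word_class R [(a, True)]) = mat 1"
      using mult[of "[(a, False)]" "[(a, True)]"] one by simp
    then show ?thesis
      using False gen[of a] eigenvector_left_inverse[OF _ v] by auto
  qed
  have "\<exists>k. \<rho> (word_class R u) *v v = k *s v" for u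
  proof (induction u)
    case Nil
    have "\<rho> (word_class R []) *v v = 1 *s v"
      by (simp add: one)
    then show ?case ..
  next
    case (Cons x u)
    obtain a b where x: "x = (a, b)" by (cases x)
    obtain k where k: "\<rho> (word_class R u) *v v = k *s v"
      using Cons.IH by blast
    obtain l where l: "\<rho> (word_class R [(a, b)]) *v v = l *s v"
      using letter by blast
    have "\<rho> (word_class R (x # u)) *v v = (k * l) *s v"
      using mult[of "[(a, b)]" u] x
      by (simp add: matrix_vector_mul_assoc[symmetric] k l vector_scalar_commute vector_smult_assoc)
    then show ?case ..
  qed
  then show ?thesis
    using g by (auto simp: presented_group_def)
qed

lemma reducible_if_common_eigenvector:
  fixes \<rho> :: "'g \<Rightarrow> complex ^ 'n ^ 'n"
  assumes "CARD('n) \<ge> 2" "v \<noteq> 0"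
    and eig: "\<And>g. g \<in> carrier G \<Longrightarrow> \<exists>k. \<rho> g *v v = k *s v"
  shows "reducible G \<rho>"
  unfolding reducible_def
proof (intro exI conjI ballI)
  let ?W = "vec.span {v}"
  show "vec.subspace ?W" by (rule vec.subspace_span)
  show "?W \<noteq> {0}"
    using assms(2) vec.span_base[of v "{v}"] by auto
  have "vec.dim ?W \<le> 1"
    using vec.dim_le_card[of ?W "{v}"] by simp
  then show "?W \<noteq> UNIV"
    using assms(1) by (metis card_cart_basis vec.dim_UNIV not_less_eq_eq numeral_2_eq_2 One_nat_def
        le_trans)
  fix g w assume g: "g \<in> carrier G" and "w \<in> ?W"
  then obtain c where w: "w = c *s v"
    by (auto simp: vec.span_singleton)
  obtain k where "\<rho> g *v v = k *s v"
    using eig[OF g] by blast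
  then have "\<rho> g *v w = c *s (k *s v)"
    by (simp add: w vector_scalar_commute)
  then show "\<rho> g *v w \<in> ?W"
    by (simp add: vec.span_scale vec.span_base)
qed

theorem mainTheorem2:
  fixes \<rho> :: "sb2_gen word set \<Rightarrow> complex ^ 2 ^ 2"
  assumes "\<rho> \<in> hom SB2 GL"
  shows "reducible SB2 \<rho>"
proof -
  define R where
    "R = {([(Sigma1, True), (Tau1, True)], [(Tau1, True), (Sigma1, True)])}"
  have SB2: "SB2 = presented_group R"
    by (simp add: SB2_def R_def)
  have hom: "\<rho> \<in> hom (presented_group R) GL"
    using assms by (simp add: SB2)
  let ?gen = "\<lambda>a. word_class R [(a, True)]"
  have mult: "\<rho> (?gen a) ** \<rho> (?gen b) = \<rho> (word_class R [(a, True), (b, True)])" for a b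
    using hom_mult[OF hom, of "?gen a" "?gen b"]
    by (simp add: mult_presented_group) (simp add: presented_group_def GL_def)
  have "word_class R [(Sigma1, True), (Tau1, True)] = word_class R [(Tau1, True), (Sigma1, True)]"
    by (simp add: word_class_eq_iff R_def word_eq.rel)
  then have "\<rho> (?gen Sigma1) ** \<rho> (?gen Tau1) = \<rho> (?gen Tau1) ** \<rho> (?gen Sigma1)"
    by (simp add: mult)
  then obtain v k l where v: "v \<noteq> 0"
    "\<rho> (?gen Sigma1) *v v = k *s v" "\<rho> (?gen Tau1) *v v = l *s v"
    by (rule commuting_matrices_common_eigenvector_2)
  then have "\<exists>k. \<rho> (?gen a) *v v = k *s v" for a
    by (cases a) auto
  then have "\<exists>k. \<rho> g *v v = k *s v" if "g \<in> carrier (presented_group R)" for g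
    using presented_group_hom_eigenvector[OF hom v(1)] that by blast
  then show ?thesis
    unfolding SB2 using v(1) by (intro reducible_if_common_eigenvector) simp_all
qed

end
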